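(* Let $G=\mathbb{Z}^k\oplus\mathbb{Z}/\mu_1\mathbb{Z}\oplus\dots\oplus\mathbb{Z}/\mu_r\mathbb{Z}$ with positive integers satisfying $\mu_r\mid\mu_{r-1}\mid\dots\mid\mu_1$, and write elements of $G$ as $(w,\eta)$ with $w=(w_1,\dots,w_k)\in\mathbb{Z}^k$ and $\eta=(\eta_1,\dots,\eta_r)$, $\eta_i\in\mathbb{Z}/\mu_i\mathbb{Z}$. Consider the following automorphisms of $G$, each of which changes only one coordinate and leaves all others unchanged: (1) for $1\le i\le k$, $\psi_i$ replaces $w_i$ by $-w_i$; (2) for $1\le i\le r$ and $u\in(\mathbb{Z}/\mu_i\mathbb{Z})^{\times}$, $\psi_{i,u}$ replaces $\eta_i$ by $u\eta_i$; (3) for $1\le i,j\le k$, $i\ne j$, $\alpha_{i,j}$ replaces $w_i$ by $w_i+w_j$; (4) for $1\le i\le r$, $1\le j\le k$, $\beta_{i,j}$ replaces $\eta_i$ by $\eta_i+ (w_j \bmod \mu_i)$; (5) for $1\le j<i\le r$, $\gamma_{i,j}$ replaces $\eta_i$ by $\eta_i+(\eta_j\bmod\mu_i)$ (well defined since $\mu_i\mid\mu_j$); (6) for $1\le i<j\le r$, $\delta_{i,j}$ replaces $\eta_i$ by $\eta_i+\frac{\mu_i}{\mu_j}\eta_j$ (well defined since $\mu_j\mid\mu_i$). Then the automorphism group $\mathrm{Aut}(G)$ is generated by all the $\psi_i,\psi_{i,u},\alpha_{i,j},\beta_{i,j},\gamma_{i,j},\delta_{i,j}$. *)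

theory Defs
  imports
    "HOL-Algebra.Elementary_Groups"
    "HOL-Algebra.Product_Groups"
    "HOL-Algebra.Generated_Groups"
    "HOL-Algebra.Bij"
begin

text \<open>
  A finite direct sum is the product over its index set. Elements are pairs \<open>(w, \<eta>)\<close> of
  functions that are extensional on \<open>{1..k}\<close> and \<open>{1..r}\<close>; residue classes modulo \<open>m > 0\<close> are
  represented by the integers in \<open>{0..<m}\<close>.
\<close>

type_synonym fg_elt = "(nat \<Rightarrow> int) \<times> (nat \<Rightarrow> int)"

definition fg_abelian :: "nat \<Rightarrow> nat \<Rightarrow> (nat \<Rightarrow> nat) \<Rightarrow> fg_elt monoid" where
  "fg_abelian k r \<mu> =
     product_group {1..k} (\<lambda>_. integer_group) \<times>\<times> product_group {1..r} (\<lambda>i. integer_mod_group (\<mu> i))"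

text \<open>
  The units of \<open>\<int>/m\<int>\<close>. For \<open>m = 1\<close> this is \<open>{0}\<close>, the unit group of the zero ring; the theory of
  \<open>residue_ring\<close> excludes that modulus, hence the explicit definition.
\<close>

definition mod_units :: "nat \<Rightarrow> int set" where
  "mod_units m = {u \<in> carrier (integer_mod_group m).
     \<exists>v \<in> carrier (integer_mod_group m). (u * v) mod int m = 1 mod int m}"

text \<open>
  All maps are restricted to the carrier, because \<open>auto\<close> consists of extensional functions.
\<close>

definition psi_free_aut :: "nat \<Rightarrow> nat \<Rightarrow> (nat \<Rightarrow> nat) \<Rightarrow> nat \<Rightarrow> fg_elt \<Rightarrow> fg_elt" where
  "psi_free_aut k r \<mu> i = restrict (\<lambda>(w, \<eta>). (w(i := - w i), \<eta>)) (carrier (fg_abelian k r \<mu>))"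

definition psi_tors_aut :: "nat \<Rightarrow> nat \<Rightarrow> (nat \<Rightarrow> nat) \<Rightarrow> nat \<Rightarrow> int \<Rightarrow> fg_elt \<Rightarrow> fg_elt" where
  "psi_tors_aut k r \<mu> i u =
     restrict (\<lambda>(w, \<eta>). (w, \<eta>(i := (u * \<eta> i) mod int (\<mu> i)))) (carrier (fg_abelian k r \<mu>))"

definition alpha_aut :: "nat \<Rightarrow> nat \<Rightarrow> (nat \<Rightarrow> nat) \<Rightarrow> nat \<Rightarrow> nat \<Rightarrow> fg_elt \<Rightarrow> fg_elt" where
  "alpha_aut k r \<mu> i j = restrict (\<lambda>(w, \<eta>). (w(i := w i + w j), \<eta>)) (carrier (fg_abelian k r \<mu>))"

definition beta_aut :: "nat \<Rightarrow> nat \<Rightarrow> (nat \<Rightarrow> nat) \<Rightarrow> nat \<Rightarrow> nat \<Rightarrow> fg_elt \<Rightarrow> fg_elt" where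
  "beta_aut k r \<mu> i j =
     restrict (\<lambda>(w, \<eta>). (w, \<eta>(i := \<eta> i \<otimes>\<^bsub>integer_mod_group (\<mu> i)\<^esub> (w j mod int (\<mu> i)))))
       (carrier (fg_abelian k r \<mu>))"

definition gamma_aut :: "nat \<Rightarrow> nat \<Rightarrow> (nat \<Rightarrow> nat) \<Rightarrow> nat \<Rightarrow> nat \<Rightarrow> fg_elt \<Rightarrow> fg_elt" where
  "gamma_aut k r \<mu> i j =
     restrict (\<lambda>(w, \<eta>). (w, \<eta>(i := \<eta> i \<otimes>\<^bsub>integer_mod_group (\<mu> i)\<^esub> (\<eta> j mod int (\<mu> i)))))
       (carrier (fg_abelian k r \<mu>))"

text \<open>
  This is used only when \<open>\<mu> j\<close> divides \<open>\<mu> i\<close>, so the division of naturals is exact, and the added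
  term is less than \<open>\<mu> i\<close>, so it needs no reduction.
\<close>

definition delta_aut :: "nat \<Rightarrow> nat \<Rightarrow> (nat \<Rightarrow> nat) \<Rightarrow> nat \<Rightarrow> nat \<Rightarrow> fg_elt \<Rightarrow> fg_elt" where
  "delta_aut k r \<mu> i j =
     restrict (\<lambda>(w, \<eta>). (w, \<eta>(i := \<eta> i \<otimes>\<^bsub>integer_mod_group (\<mu> i)\<^esub> (int (\<mu> i div \<mu> j) * \<eta> j))))
       (carrier (fg_abelian k r \<mu>))"

definition elementary_auts :: "nat \<Rightarrow> nat \<Rightarrow> (nat \<Rightarrow> nat) \<Rightarrow> (fg_elt \<Rightarrow> fg_elt) set" where
  "elementary_auts k r \<mu> =
     {psi_free_aut k r \<mu> i | i. i \<in> {1..k}}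
   \<union> {psi_tors_aut k r \<mu> i u | i u. i \<in> {1..r} \<and> u \<in> mod_units (\<mu> i)}
   \<union> {alpha_aut k r \<mu> i j | i j. i \<in> {1..k} \<and> j \<in> {1..k} \<and> i \<noteq> j}
   \<union> {beta_aut k r \<mu> i j | i j. i \<in> {1..r} \<and> j \<in> {1..k}}
   \<union> {gamma_aut k r \<mu> i j | i j. 1 \<le> j \<and> j < i \<and> i \<le> r}
   \<union> {delta_aut k r \<mu> i j | i j. 1 \<le> i \<and> i < j \<and> j \<le> r}"

end

theory Submission
  imports Defs "HOL-Number_Theory.Cong"
begin

text \<open>
  Give \<open>\<int>\<close> the modulus \<open>0\<close>, so that both kinds of summands are cyclic groups \<open>\<int>/m i\<close>; the elementary
  automorphisms other than unit scalings are then transvections \<open>x i \<mapsto> x i + c * x j\<close>, whose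
  coefficients generate the ideal of all \<open>a\<close> with \<open>m i dvd m j * a\<close>. Suppose that the
  automorphism \<open>\<phi>\<close> fixes the first \<open>s\<close> basis vectors and let \<open>y\<close> be its value at the next one, \<open>e\<close>. The
  \<open>s\<close>-th coordinate of the inverse of \<open>\<phi>\<close> expresses \<open>1\<close> modulo \<open>m s\<close> as a linear combination of the
  coordinates of \<open>y\<close> from \<open>s\<close> on. Hence transvections that fix the earlier basis vectors make
  coordinate \<open>s\<close> of \<open>y\<close> a unit: for \<open>m s = 0\<close> by the Euclidean algorithm, and otherwise because
  \<open>\<int>/m s\<close> has stable range one. After scaling that coordinate to \<open>1\<close>, the other coordinates can be
  cleared, since \<open>m s * y = 0\<close> makes the required coefficients admissible, and \<open>y\<close> has become \<open>e\<close>.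
\<close>

section \<open>Groups with cyclic coordinates\<close>

text \<open>Take for \<open>t\<close> the product of the primes that divide \<open>m\<close> but not
  \<open>a\<close>. A prime divisor of \<open>m\<close> then divides exactly one of the summands
  \<open>a\<close> and \<open>t * b\<close>: if it divides \<open>a\<close>, it divides neither
  \<open>t\<close> nor, by \<open>cop\<close>, \<open>b\<close>; otherwise it divides
  \<open>t\<close>.\<close>

lemma coprime_add_multiple:
  fixes a b m :: int
  assumes "m \<noteq> 0" and cop: "\<And>d. d dvd a \<Longrightarrow> d dvd b \<Longrightarrow> d dvd m \<Longrightarrow> is_unit d"
  shows "\<exists>t. coprime (a + t * b) m"
proof
  define t where "t = \<Prod>{p \<in> prime_factors m. \<not> p dvd a}"
  have t_dvd: "p dvd t" if "prime p" "p dvd m" "\<not> p dvd a" for p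
    unfolding t_def using that \<open>m \<noteq> 0\<close> by (intro dvd_prodI) (auto simp: prime_factors_dvd)
  have t_ndvd: "\<not> p dvd t" if "prime p" "p dvd a" for p
  proof
    assume "p dvd t"
    then have "\<exists>q \<in> {p \<in> prime_factors m. \<not> p dvd a}. p dvd q"
      unfolding t_def using that(1) by (subst (asm) prime_dvd_prod_iff) auto
    then obtain q where "q \<in> prime_factors m" "\<not> q dvd a" "p dvd q" by blast
    then show False
      using that primes_dvd_imp_eq[of p q] in_prime_factors_imp_prime[of q m] by auto
  qed
  show "coprime (a + t * b) m"
  proof (rule ccontr)
    assume "\<not> coprime (a + t * b) m"
    then obtain c where c: "c dvd a + t * b" "c dvd m" "\<not> is_unit c" by (rule not_coprimeE)
    then have "c \<noteq> 0" using \<open>m \<noteq> 0\<close> by auto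
    then obtain p where "prime p" "p dvd c" using c prime_divisor_exists[of c] by blast
    with c have p: "prime p" "p dvd a + t * b" "p dvd m" by (auto intro: dvd_trans)
    show False
    proof (cases "p dvd a")
      case True
      then have "p dvd t * b" using p by (simp add: dvd_add_right_iff)
      then have "p dvd b" using t_ndvd[of p] True p prime_dvd_mult_iff[of p t b] by blast
      then show False using cop[OF True] p not_prime_unit[of p] by blast
    next
      case False
      then show False using t_dvd[of p] p dvd_add_left_iff[of p "t * b" a] by auto
    qed
  qed
qed

text \<open>The three axioms make \<open>co\<close> induce an isomorphism from \<open>G\<close> onto
  the product of the groups \<int>/\<open>m i\<close>. The value \<open>co x i\<close> is any
  representative of its class, so that free and torsion coordinates are treated alike.\<close>

locale cyclic_coordinates = group G for G (structure) +
  fixes co :: "'a \<Rightarrow> nat \<Rightarrow> int" and n :: nat and m :: "nat \<Rightarrow> int"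
  assumes co_mult: "\<lbrakk>x \<in> carrier G; y \<in> carrier G; i < n\<rbrakk> \<Longrightarrow> [co (x \<otimes> y) i = co x i + co y i] (mod m i)"
    and co_eqI: "\<lbrakk>x \<in> carrier G; y \<in> carrier G; \<And>i. i < n \<Longrightarrow> [co x i = co y i] (mod m i)\<rbrakk> \<Longrightarrow> x = y"
    and co_surj: "\<exists>x \<in> carrier G. \<forall>i<n. [co x i = f i] (mod m i)"
begin

text \<open>By \<open>co_surj\<close> and \<open>co_eqI\<close> exactly one element qualifies; for
  \<open>j \<ge> n\<close> it is the neutral element.\<close>

definition basis :: "nat \<Rightarrow> 'a" where
  "basis j = (SOME x. x \<in> carrier G \<and> (\<forall>i<n. [co x i = (if i = j then 1 else 0)] (mod m i)))"

lemma basis: "basis j \<in> carrier G" "i < n \<Longrightarrow> [co (basis j) i = (if i = j then 1 else 0)] (mod m i)"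
proof -
  have "basis j \<in> carrier G \<and> (\<forall>i<n. [co (basis j) i = (if i = j then 1 else 0)] (mod m i))"
    unfolding basis_def by (rule someI_ex) (use co_surj[of "\<lambda>i. if i = j then 1 else 0"] in blast)
  then show "basis j \<in> carrier G" "i < n \<Longrightarrow> [co (basis j) i = (if i = j then 1 else 0)] (mod m i)"
    by auto
qed

lemma co_one: "i < n \<Longrightarrow> [co \<one> i = 0] (mod m i)"
  using co_mult[of \<one> \<one> i] by (simp add: cong_iff_dvd_diff)

lemma co_inv:
  assumes "x \<in> carrier G" "i < n"
  shows "[co (inv x) i = - co x i] (mod m i)"
proof -
  have "[co (inv x) i + co x i = 0] (mod m i)"
    using co_mult[of "inv x" x i] co_one[of i] assms by (metis cong_sym cong_trans inv_closed l_inv)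
  then show ?thesis by (simp add: cong_iff_dvd_diff)
qed

lemma co_nat_pow:
  assumes "x \<in> carrier G" "i < n"
  shows "[co (x [^] (N::nat)) i = int N * co x i] (mod m i)"
proof (induction N)
  case 0
  then show ?case using co_one assms by simp
next
  case (Suc N)
  have "[co (x [^] Suc N) i = co (x [^] N) i + co x i] (mod m i)"
    using co_mult assms by simp
  also have "[co (x [^] N) i + co x i = int N * co x i + co x i] (mod m i)"
    using Suc by (intro cong_add) auto
  finally show ?case by (simp add: algebra_simps)
qed

lemma co_int_pow:
  assumes "x \<in> carrier G" "i < n"
  shows "[co (x [^] (z::int)) i = z * co x i] (mod m i)"
proof (cases z rule: int_cases2)
  case (nonneg N)
  then show ?thesis using co_nat_pow[OF assms] by (simp add: int_pow_int)
next
  case (nonpos N)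
  have "[co (inv (x [^] N)) i = - co (x [^] N) i] (mod m i)"
    using co_inv assms by simp
  also have "[- co (x [^] N) i = - (int N * co x i)] (mod m i)"
    using co_nat_pow[OF assms] by (simp only: cong_minus_minus_iff)
  finally show ?thesis using nonpos assms by (simp add: int_pow_neg_int)
qed

section \<open>Endomorphisms as integer matrices\<close>

text \<open>The second assumption says that multiplication by \<open>a\<close> is well defined from
  \<int>/\<open>m j\<close> to \<int>/\<open>m i\<close>. Such coefficients are called admissible
  below.\<close>

lemma mult_cong:
  assumes "[p = q] (mod m j)" "m i dvd m j * a"
  shows "[a * p = a * q] (mod m i)"
proof -
  have "m j * a dvd (p - q) * a" using assms(1) by (simp add: cong_iff_dvd_diff)
  then have "m i dvd (p - q) * a" using assms(2) dvd_trans by blast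
  then show ?thesis by (simp add: cong_iff_dvd_diff algebra_simps)
qed

text \<open>The matrix entries of an endomorphism are admissible: \<open>basis j\<close> is
  annihilated by \<open>m j\<close>, hence so is its image.\<close>

lemma modulus_dvd_co_hom:
  assumes \<phi>: "\<phi> \<in> hom G G" and i: "i < n"
  shows "m i dvd m j * co (\<phi> (basis j)) i"
proof -
  interpret group_hom G G \<phi>
    by (rule group_hom.intro) (use \<phi> in \<open>auto simp: group_hom_axioms_def is_group\<close>)
  have "basis j [^] m j = \<one>"
  proof (rule co_eqI)
    fix l assume l: "l < n"
    have "[co (basis j [^] m j) l = m j * co (basis j) l] (mod m l)"
      by (rule co_int_pow) (use basis l in auto)
    also have "[m j * co (basis j) l = m j * (if l = j then 1 else 0)] (mod m l)"
      using basis l by (intro cong_scalar_left) auto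
    also have "[m j * (if l = j then 1 else 0) = 0] (mod m l)" by (auto simp: cong_iff_dvd_diff)
    finally show "[co (basis j [^] m j) l = co \<one> l] (mod m l)"
      by (rule cong_trans[OF _ cong_sym[OF co_one[OF l]]])
  qed (use basis in auto)
  then have "\<phi> (basis j) [^] m j = \<one>" using basis(1)[of j] hom_int_pow[of "basis j" "m j"] hom_one by simp
  then have "[m j * co (\<phi> (basis j)) i = 0] (mod m i)"
    using cong_trans[OF cong_sym[OF co_int_pow[of "\<phi> (basis j)" i "m j"]]] co_one[OF i] i basis by simp
  then show ?thesis by (simp add: cong_iff_dvd_diff)
qed

lemma co_hom:
  assumes \<phi>: "\<phi> \<in> hom G G" and x: "x \<in> carrier G" and i: "i < n"
  shows "[co (\<phi> x) i = (\<Sum>j<n. co x j * co (\<phi> (basis j)) i)] (mod m i)"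
proof -
  interpret group_hom G G \<phi>
    by (rule group_hom.intro) (use \<phi> in \<open>auto simp: group_hom_axioms_def is_group\<close>)
  \<comment> \<open>Induction on a bound \<open>N\<close> beyond which all coordinates of
    \<open>x\<close> vanish.\<close>
  have "[co (\<phi> x) i = (\<Sum>j<N. co x j * co (\<phi> (basis j)) i)] (mod m i)"
    if "N \<le> n" "x \<in> carrier G" "\<And>l. N \<le> l \<Longrightarrow> l < n \<Longrightarrow> [co x l = 0] (mod m l)" for N x
    using that
  proof (induction N arbitrary: x)
    case 0
    have "x = \<one>"
      by (rule co_eqI) (use 0 in \<open>auto intro: cong_trans[OF _ cong_sym[OF co_one]]\<close>)
    then show ?case using co_one i by simp
  next
    case (Suc N)
    \<comment> \<open>Split off the last coordinate: \<open>y\<close> is \<open>x\<close> with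
      coordinate \<open>N\<close> replaced by zero.\<close>
    obtain y where y: "y \<in> carrier G" "\<forall>l<n. [co y l = (if l < N then co x l else 0)] (mod m l)"
      using co_surj[of "\<lambda>l. if l < N then co x l else 0"] by blast
    have [simp]: "basis N \<in> carrier G" by (rule basis)
    have x: "x = y \<otimes> basis N [^] co x N"
    proof (rule co_eqI)
      fix l assume l: "l < n"
      have "[co (y \<otimes> basis N [^] co x N) l = co y l + co (basis N [^] co x N) l] (mod m l)"
        using y l by (intro co_mult) auto
      also have "[co y l + co (basis N [^] co x N) l
          = (if l < N then co x l else 0) + co x N * (if l = N then 1 else 0)] (mod m l)"
        using y l by (intro cong_add cong_trans[OF co_int_pow cong_scalar_left[OF basis(2)]]) auto
      also have "[(if l < N then co x l else 0) + co x N * (if l = N then 1 else 0) = co x l] (mod m l)"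
        using Suc.prems(3)[of l] l by (auto simp: cong_sym_eq)
      finally show "[co x l = co (y \<otimes> basis N [^] co x N) l] (mod m l)" by (rule cong_sym)
    qed (use Suc y in auto)
    have "\<phi> x = \<phi> y \<otimes> \<phi> (basis N) [^] co x N"
      using y by (subst x) (simp add: hom_int_pow)
    then have "[co (\<phi> x) i = co (\<phi> y) i + co (\<phi> (basis N) [^] co x N) i] (mod m i)"
      using co_mult i y by simp
    also have "[co (\<phi> y) i + co (\<phi> (basis N) [^] co x N) i
        = (\<Sum>j<N. co y j * co (\<phi> (basis j)) i) + co x N * co (\<phi> (basis N)) i] (mod m i)"
      using Suc.prems y i by (intro cong_add Suc.IH co_int_pow) auto
    also have "[(\<Sum>j<N. co y j * co (\<phi> (basis j)) i) + co x N * co (\<phi> (basis N)) i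
        = (\<Sum>j<N. co x j * co (\<phi> (basis j)) i) + co x N * co (\<phi> (basis N)) i] (mod m i)"
    proof (intro cong_add cong_sum cong_refl)
      fix j assume j: "j \<in> {..<N}"
      \<comment> \<open>The coordinates of \<open>y\<close> and \<open>x\<close> agree only modulo
        \<open>m j\<close>, whereas the sum is taken modulo \<open>m i\<close>; admissibility of the
        matrix entry bridges the two.\<close>
      have "m i dvd m j * co (\<phi> (basis j)) i" using modulus_dvd_co_hom[OF \<phi> i] .
      then show "[co y j * co (\<phi> (basis j)) i = co x j * co (\<phi> (basis j)) i] (mod m i)"
        using mult_cong[of "co y j" "co x j" j i "co (\<phi> (basis j)) i"] y(2)[rule_format, of j] j Suc.prems(1)
        by (simp add: mult.commute)
    qed
    finally show ?case by simp
  qed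
  from this[of n x] show ?thesis using x by simp
qed

section \<open>Maps that change a single coordinate\<close>

text \<open>One shape for both kinds of generators: \<open>u = 1\<close> with
  \<open>i \<noteq> j\<close> gives a transvection, \<open>a = 0\<close> gives a scaling.\<close>

definition updates :: "nat \<Rightarrow> int \<Rightarrow> int \<Rightarrow> nat \<Rightarrow> ('a \<Rightarrow> 'a) \<Rightarrow> bool" where
  "updates i u a j h \<longleftrightarrow> (\<forall>x \<in> carrier G. \<forall>l<n.
     [co (h x) l = (if l = i then u * co x i + a * co x j else co x l)] (mod m l))"

lemma updatesD:
  assumes "updates i u a j h" "x \<in> carrier G" "l < n"
  shows "[co (h x) l = (if l = i then u * co x i + a * co x j else co x l)] (mod m l)"
  using assms unfolding updates_def by blast

text \<open>Admissibility of \<open>a\<close> makes the map additive. If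
  \<open>a \<noteq> 0\<close>, then coordinate \<open>j\<close> is unchanged, so its multiple can be
  subtracted again and \<open>u\<close> cancelled modulo \<open>m i\<close>.\<close>

lemma updates_auto:
  assumes h: "h \<in> extensional (carrier G)" "h \<in> carrier G \<rightarrow> carrier G" "updates i u a j h"
    and ij: "i < n" "j < n" "a = 0 \<or> i \<noteq> j"
    and u: "coprime u (m i)" and a: "m i dvd m j * a"
  shows "h \<in> auto G"
proof -
  have hc[simp]: "h x \<in> carrier G" if "x \<in> carrier G" for x using h(2) that by blast
  have mult: "h (x \<otimes> y) = h x \<otimes> h y" if xy: "x \<in> carrier G" "y \<in> carrier G" for x y
  proof (rule co_eqI)
    fix l assume l: "l < n"
    have "[co (h (x \<otimes> y)) l
        = (if l = i then u * co (x \<otimes> y) i + a * co (x \<otimes> y) j else co (x \<otimes> y) l)] (mod m l)"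
      using xy l h by (intro updatesD) auto
    also have "[(if l = i then u * co (x \<otimes> y) i + a * co (x \<otimes> y) j else co (x \<otimes> y) l)
       = (if l = i then u * (co x i + co y i) + a * (co x j + co y j) else co x l + co y l)] (mod m l)"
    proof (cases "l = i")
      case True
      have "[a * co (x \<otimes> y) j = a * (co x j + co y j)] (mod m i)"
        by (intro mult_cong[OF co_mult] xy ij a)
      then show ?thesis using True xy ij
        by (simp add: cong_add cong_scalar_left co_mult)
    qed (use xy l in \<open>simp add: co_mult\<close>)
    also have "(if l = i then u * (co x i + co y i) + a * (co x j + co y j) else co x l + co y l)
       = (if l = i then u * co x i + a * co x j else co x l)
         + (if l = i then u * co y i + a * co y j else co y l)"
      by (simp add: algebra_simps)
    also have "[\<dots> = co (h x) l + co (h y) l] (mod m l)"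
      using xy l h by (intro cong_add cong_sym[OF updatesD]) auto
    also have "[co (h x) l + co (h y) l = co (h x \<otimes> h y) l] (mod m l)"
      using xy l by (intro cong_sym[OF co_mult]) auto
    finally show "[co (h (x \<otimes> y)) l = co (h x \<otimes> h y) l] (mod m l)" .
  qed (use xy in auto)
  obtain v where v: "[u * v = 1] (mod m i)" using u cong_solve_coprime_int by blast
  have inj: "x = y" if xy: "x \<in> carrier G" "y \<in> carrier G" "h x = h y" for x y
  proof (rule co_eqI)
    have eq: "[(if l = i then u * co x i + a * co x j else co x l)
       = (if l = i then u * co y i + a * co y j else co y l)] (mod m l)" if "l < n" for l
      using updatesD[OF h(3) xy(1) that] updatesD[OF h(3) xy(2) that] xy(3) 
      by (metis (no_types, lifting) cong_sym cong_trans)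
    have "[a * co x j = a * co y j] (mod m i)"
      using ij eq[of j] a by (cases "a = 0") (auto intro: mult_cong)
    then have "[u * co x i = u * co y i] (mod m i)"
      using cong_diff[OF eq[of i]] ij by fastforce
    then have "[co x i = co y i] (mod m i)"
      using u by (simp add: cong_mult_lcancel)
    then show "[co x l = co y l] (mod m l)" if "l < n" for l
      using eq[of l] that by (cases "l = i") auto
  qed (use xy in auto)
  have surj: "\<exists>x \<in> carrier G. h x = y" if y: "y \<in> carrier G" for y
  proof -
    \<comment> \<open>The preimage solves \<open>u * co x i + a * co x j = co y i\<close> for
      \<open>co x i\<close>, with \<open>v\<close> the inverse of \<open>u\<close>.\<close>
    obtain x where x: "x \<in> carrier G"
      "\<And>l. l < n \<Longrightarrow> [co x l = (if l = i then v * (co y i - a * co y j) else co y l)] (mod m l)"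
      using co_surj[of "\<lambda>l. if l = i then v * (co y i - a * co y j) else co y l"] by blast
    have "h x = y"
    proof (rule co_eqI)
      fix l assume l: "l < n"
      have *: "[u * co x i + a * co x j = co y i] (mod m i)"
      proof -
        have "[a * co x j = a * co y j] (mod m i)"
          using ij x(2)[of j] a by (cases "a = 0") (auto intro: mult_cong)
        moreover have "[u * co x i = (u * v) * (co y i - a * co y j)] (mod m i)"
          using x(2)[OF ij(1)] cong_scalar_left[of "co x i" _ "m i" u] by (simp add: mult.assoc)
        moreover have "[(u * v) * (co y i - a * co y j) = 1 * (co y i - a * co y j)] (mod m i)"
          using v by (rule cong_scalar_right)
        ultimately have "[u * co x i + a * co x j = 1 * (co y i - a * co y j) + a * co y j] (mod m i)"
          by (meson cong_add cong_trans)
        then show ?thesis by simp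
      qed
      show "[co (h x) l = co y l] (mod m l)"
        using updatesD[OF h(3) x(1) l] x(2)[OF l] * cong_trans by (cases "l = i") auto
    qed (use x y in auto)
    with x show ?thesis by blast
  qed
  have "bij_betw h (carrier G) (carrier G)"
    unfolding bij_betw_def by (intro conjI inj_onI) (auto intro: inj dest: surj)
  with mult h show ?thesis by (auto simp: auto_def hom_def Bij_def)
qed

end

section \<open>Reduction by transvections\<close>

text \<open>
  Below, \<open>m i div gcd (m i) (m j)\<close> generates the ideal of all \<open>a\<close> with \<open>m i dvd m j * a\<close>. The case
  distinction is needed for \<open>m i = m j = 0\<close>, where the quotient is \<open>0 div 0 = 0\<close>.
\<close>

locale transvection_closed = cyclic_coordinates +
  fixes H :: "('a \<Rightarrow> 'a) set"
  assumes subgroup_H: "subgroup H (AutoGroup G)"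
    and scaling: "\<lbrakk>i < n; coprime u (m i)\<rbrakk> \<Longrightarrow> \<exists>h \<in> H. updates i u 0 i h"
    and transvection: "\<lbrakk>i < n; j < n; i \<noteq> j\<rbrakk> \<Longrightarrow>
      \<exists>h \<in> H. updates i 1 (if m j = 0 then 1 else m i div gcd (m i) (m j)) j h"
begin

lemma H_auto: "h \<in> H \<Longrightarrow> h \<in> auto G"
  using subgroup.subset[OF subgroup_H] by (auto simp: AutoGroup_def)

lemma H_closed [simp]: "h \<in> H \<Longrightarrow> x \<in> carrier G \<Longrightarrow> h x \<in> carrier G"
  using H_auto by (auto simp: auto_def hom_def)

lemma H_id: "(\<lambda>x \<in> carrier G. x) \<in> H"
  using subgroup.one_closed[OF subgroup_H] by (simp add: AutoGroup_def BijGroup_def)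

lemma H_compose:
  assumes "h \<in> H" "g \<in> H"
  shows "compose (carrier G) h g \<in> H"
  using subgroup.m_closed[OF subgroup_H assms] H_auto[OF assms(1)] H_auto[OF assms(2)]
  by (simp add: AutoGroup_def BijGroup_def auto_def)

lemma H_inv:
  assumes "h \<in> H"
  shows "\<exists>g \<in> H. \<forall>x \<in> carrier G. g (h x) = x \<and> h (g x) = x"
proof
  interpret A: group "AutoGroup G" by (rule AutoGroup)
  let ?g = "inv\<^bsub>AutoGroup G\<^esub> h"
  show g: "?g \<in> H" using subgroup.m_inv_closed[OF subgroup_H assms] .
  have hc: "h \<in> carrier (AutoGroup G)" using assms subgroup.subset[OF subgroup_H] by blast
  have bij: "h \<in> Bij (carrier G)" "?g \<in> Bij (carrier G)"
    using H_auto[OF assms] H_auto[OF g] by (auto simp: auto_def)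
  have "compose (carrier G) ?g h = (\<lambda>x \<in> carrier G. x)" "compose (carrier G) h ?g = (\<lambda>x \<in> carrier G. x)"
    using A.l_inv[OF hc] A.r_inv[OF hc] bij by (simp_all add: AutoGroup_def BijGroup_def)
  then show "\<forall>x \<in> carrier G. ?g (h x) = x \<and> h (?g x) = x"
    by (metis compose_eq restrict_apply')
qed

section \<open>All transvections with admissible coefficients\<close>

text \<open>The coefficients add up because \<open>g\<close> leaves the source coordinate
  \<open>j\<close> unchanged modulo \<open>m j\<close>, and \<open>a\<close> is admissible.\<close>

lemma updates_compose:
  assumes "g \<in> H" "updates i 1 a j h" "updates i 1 b j g" "i < n" "j < n" "i \<noteq> j" "m i dvd m j * a"
  shows "updates i 1 (a + b) j (compose (carrier G) h g)"
  unfolding updates_def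
proof (intro ballI allI impI)
  fix x l assume x: "x \<in> carrier G" and l: "l < n"
  have gx: "g x \<in> carrier G" using assms x by simp
  have h: "[co (compose (carrier G) h g x) l = (if l = i then co (g x) i + a * co (g x) j else co (g x) l)] (mod m l)"
    using updatesD[OF assms(2) gx l] x by (cases "l = i") (simp_all add: compose_eq)
  show "[co (compose (carrier G) h g x) l = (if l = i then 1 * co x i + (a + b) * co x j else co x l)] (mod m l)"
  proof (cases "l = i")
    case True
    have "[a * co (g x) j = a * co x j] (mod m i)"
      using updatesD[OF assms(3) x, of j] assms by (intro mult_cong) auto
    with updatesD[OF assms(3) x l] True
    have "[co (g x) i + a * co (g x) j = (co x i + b * co x j) + a * co x j] (mod m i)"
      by (intro cong_add) auto
    with h True show ?thesis by (auto simp: algebra_simps intro: cong_trans)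
  next
    case False
    then show ?thesis using h updatesD[OF assms(3) x l] by (auto intro: cong_trans)
  qed
qed

lemma updates_inv:
  assumes "g \<in> H" "h \<in> H" "updates i 1 a j h" "i < n" "j < n" "i \<noteq> j" "m i dvd m j * a"
    and inv: "\<And>x. x \<in> carrier G \<Longrightarrow> h (g x) = x"
  shows "updates i 1 (- a) j g"
  unfolding updates_def
proof (intro ballI allI impI)
  fix x l assume x: "x \<in> carrier G" and l: "l < n"
  have gx: "g x \<in> carrier G" using assms x by simp
  have h: "[co x l = (if l = i then co (g x) i + a * co (g x) j else co (g x) l)] (mod m l)" if "l < n" for l
    using updatesD[OF assms(3) gx that] x inv by (cases "l = i") simp_all
  show "[co (g x) l = (if l = i then 1 * co x i + (- a) * co x j else co x l)] (mod m l)"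
  proof (cases "l = i")
    case True
    have "[a * co x j = a * co (g x) j] (mod m i)"
      using h[of j] assms by (intro mult_cong) auto
    with h[of i] \<open>i < n\<close> have "[co x i - a * co x j = (co (g x) i + a * co (g x) j) - a * co (g x) j] (mod m i)"
      by (intro cong_diff) auto
    with True show ?thesis by (simp add: cong_sym_eq)
  next
    case False
    then show ?thesis using h[OF l] by (auto intro: cong_sym)
  qed
qed

lemma updates_id: "updates i 1 0 j (\<lambda>x \<in> carrier G. x)"
  by (simp add: updates_def)

text \<open>Composition and inversion yield all integer multiples of the coefficient
  \<open>c\<close> provided by \<open>transvection\<close>, and \<open>c\<close> divides every
  admissible \<open>a\<close>.\<close>

lemma transvection_multiple:
  assumes ij: "i < n" "j < n" "i \<noteq> j" and a: "m i dvd m j * a"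
  shows "\<exists>h \<in> H. updates i 1 a j h"
proof -
  define c where "c = (if m j = 0 then 1 else m i div gcd (m i) (m j))"
  have c: "m i dvd m j * c"
  proof (cases "m j = 0")
    case False
    have "m i dvd m i * (m j div gcd (m i) (m j))" by simp
    also have "m i * (m j div gcd (m i) (m j)) = m j * (m i div gcd (m i) (m j))"
      by (metis div_mult_swap gcd_dvd1 gcd_dvd2 mult.commute)
    finally show ?thesis using False by (simp add: c_def)
  qed simp
  obtain h where h: "h \<in> H" "updates i 1 c j h"
    using transvection[OF ij] unfolding c_def by blast
  have nat: "\<exists>h \<in> H. updates i 1 (int N * c) j h" for N
  proof (induction N)
    case 0
    then show ?case using H_id updates_id by auto
  next
    case (Suc N)
    then obtain g where "g \<in> H" "updates i 1 (int N * c) j g" by blast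
    then have "updates i 1 (c + int N * c) j (compose (carrier G) h g)" "compose (carrier G) h g \<in> H"
      using updates_compose h ij c H_compose by auto
    then show ?case by (auto simp: algebra_simps)
  qed
  \<comment> \<open>After division by the gcd of the moduli, \<open>m i div g\<close> divides
    \<open>(m j div g) * a\<close> and is coprime to the first factor. For \<open>m j = 0\<close>
    the claim is trivial, as \<open>c = 1\<close>.\<close>
  have "c dvd a"
  proof (cases "m j = 0")
    case False
    define g where "g = gcd (m i) (m j)"
    have "g \<noteq> 0" using False by (simp add: g_def)
    have "coprime (m i div g) (m j div g)" unfolding g_def
      using False by (intro div_gcd_coprime) auto
    moreover have "m i div g dvd (m j div g) * a"
    proof -
      have "g * (m i div g) dvd g * ((m j div g) * a)"
        using a by (simp add: g_def mult.assoc[symmetric])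
      then show ?thesis using \<open>g \<noteq> 0\<close> by (simp only: dvd_mult_cancel_left simp_thms)
    qed
    ultimately show ?thesis using False
      by (simp add: c_def g_def coprime_dvd_mult_right_iff)
  qed (simp add: c_def)
  then obtain z where z: "a = z * c" by (metis dvd_def mult.commute)
  show ?thesis
  proof (cases z rule: int_cases2)
    case (nonneg N)
    then show ?thesis using nat[of N] z by simp
  next
    case (nonpos N)
    obtain g where g: "g \<in> H" "updates i 1 (int N * c) j g" using nat by blast
    then obtain g' where g': "g' \<in> H" "\<forall>x \<in> carrier G. g (g' x) = x" using H_inv by blast
    have "updates i 1 (- (int N * c)) j g'"
      by (rule updates_inv[OF g'(1) g ij]) (use c g' in \<open>auto simp: mult.left_commute\<close>)
    then show ?thesis using g' z nonpos by auto
  qed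
qed

section \<open>Stabilizers of initial basis vectors\<close>

definition stab :: "nat \<Rightarrow> ('a \<Rightarrow> 'a) set" where
  "stab s = {h \<in> H. \<forall>l<s. h (basis l) = basis l}"

lemma stab_H: "h \<in> stab s \<Longrightarrow> h \<in> H"
  by (simp add: stab_def)

lemma stab_id: "(\<lambda>x \<in> carrier G. x) \<in> stab s"
  by (simp add: stab_def H_id basis)

lemma stab_compose: "h \<in> stab s \<Longrightarrow> g \<in> stab s \<Longrightarrow> compose (carrier G) h g \<in> stab s"
  by (simp add: stab_def H_compose basis compose_eq)

text \<open>For \<open>l < s\<close> coordinate \<open>j \<ge> s\<close> of \<open>basis l\<close>
  is zero, so nothing is added, and a scaling with \<open>s \<le> i\<close> acts on a zero
  coordinate. A transvection may have a target \<open>i < s\<close>; only its source must not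
  precede \<open>s\<close>.\<close>

lemma updates_stab:
  assumes h: "h \<in> H" "updates i u a j h" and ij: "i < n" "j < n" "s \<le> j" and a: "m i dvd m j * a"
    and u: "s \<le> i \<or> u = 1"
  shows "h \<in> stab s"
  unfolding stab_def
proof (intro CollectI conjI allI impI)
  fix l assume l: "l < s"
  show "h (basis l) = basis l"
  proof (rule co_eqI)
    fix l' assume l': "l' < n"
    have j: "[a * co (basis l) j = a * 0] (mod m i)"
      using basis(2)[of j l] ij l a by (intro mult_cong) auto
    have "[u * co (basis l) i = co (basis l) i] (mod m i)"
    proof (cases "u = 1")
      case False
      then have "[co (basis l) i = 0] (mod m i)" using basis(2)[of i l] ij l u by auto
      then have "m i dvd co (basis l) i" by (simp add: cong_iff_dvd_diff)
      then show ?thesis by (simp add: cong_iff_dvd_diff)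
    qed simp
    from cong_add[OF this j] have "[u * co (basis l) i + a * co (basis l) j = co (basis l) i] (mod m i)" by simp
    then show "[co (h (basis l)) l' = co (basis l) l'] (mod m l')"
      using updatesD[OF h(2) basis(1) l', of l] by (auto intro: cong_trans split: if_splits)
  qed (use h basis in auto)
qed (rule h)

lemma stab_transvection:
  assumes "i < n" "j < n" "i \<noteq> j" "s \<le> j" "m i dvd m j * a"
  shows "\<exists>h \<in> stab s. updates i 1 a j h"
  using transvection_multiple[of i j a] updates_stab[of _ i 1 a j s] assms by blast

lemma stab_scaling:
  assumes "i < n" "s \<le> i" "coprime u (m i)"
  shows "\<exists>h \<in> stab s. updates i u 0 i h"
  using scaling[of i u] updates_stab[of _ i u 0 i s] assms by auto

text \<open>All transvections used have target \<open>s\<close> and sources after \<open>s\<close>,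
  so no source changes on the way and the coefficients can be applied one after the other.\<close>

lemma add_combination:
  assumes "finite F" "F \<subseteq> {s<..<n}" "s < n" "y \<in> carrier G" "\<And>j. j \<in> F \<Longrightarrow> m s dvd m j * f j"
  shows "\<exists>h \<in> stab s. \<forall>l<n. [co (h y) l = co y l + (if l = s then \<Sum>j\<in>F. f j * co y j else 0)] (mod m l)"
  using assms
proof (induction F rule: finite_induct)
  case empty
  then show ?case by (intro bexI[OF _ stab_id]) auto
next
  case (insert j F)
  then obtain h where h: "h \<in> stab s"
    "\<And>l. l < n \<Longrightarrow> [co (h y) l = co y l + (if l = s then \<Sum>j\<in>F. f j * co y j else 0)] (mod m l)"
    by auto
  obtain t where t: "t \<in> stab s" "updates s 1 (f j) j t"
    using stab_transvection[of s j s "f j"] insert by auto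
  have hy: "h y \<in> carrier G" using h stab_H insert by auto
  have "[co (compose (carrier G) t h y) l = co y l + (if l = s then \<Sum>j\<in>insert j F. f j * co y j else 0)] (mod m l)"
    if l: "l < n" for l
  proof -
    have *: "[co (compose (carrier G) t h y) l = (if l = s then co (h y) s + f j * co (h y) j else co (h y) l)] (mod m l)"
      using updatesD[OF t(2) hy l] \<open>y \<in> carrier G\<close> by (cases "l = s") (simp_all add: compose_eq)
    show ?thesis
    proof (cases "l = s")
      case True
      have "[f j * co (h y) j = f j * co y j] (mod m s)"
        using h(2)[of j] insert.prems by (intro mult_cong) auto
      with h(2)[OF l] True
      have "[co (h y) s + f j * co (h y) j = (co y s + (\<Sum>j\<in>F. f j * co y j)) + f j * co y j] (mod m s)"
        by (intro cong_add) auto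
      with * True show ?thesis using insert.hyps by (auto simp: algebra_simps intro: cong_trans)
    next
      case False
      then show ?thesis using * h(2)[OF l] by (auto intro: cong_trans)
    qed
  qed
  then show ?case using stab_compose t h by blast
qed

text \<open>Here \<open>s\<close> is always the source: its coordinate stays \<open>1\<close>, so
  adding \<open>- co y i\<close> times it to coordinate \<open>i\<close> gives zero. Targets before
  \<open>s\<close> are allowed.\<close>

lemma clear_coordinates:
  assumes "finite F" "F \<subseteq> {..<n} - {s}" "s < n" "y \<in> carrier G" "[co y s = 1] (mod m s)"
    "\<And>i. i \<in> F \<Longrightarrow> m i dvd m s * co y i"
  shows "\<exists>h \<in> stab s. \<forall>l<n. [co (h y) l = (if l \<in> F then 0 else co y l)] (mod m l)"
  using assms
proof (induction F rule: finite_induct)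
  case empty
  then show ?case by (intro bexI[OF _ stab_id]) auto
next
  case (insert i F)
  then obtain h where h: "h \<in> stab s"
    "\<And>l. l < n \<Longrightarrow> [co (h y) l = (if l \<in> F then 0 else co y l)] (mod m l)"
    by auto
  have i: "i < n" "i \<noteq> s" "m i dvd m s * - co y i" using insert.prems by auto
  obtain t where t: "t \<in> stab s" "updates i 1 (- co y i) s t"
    using stab_transvection[of i s s "- co y i"] insert.prems i by auto
  have hy: "h y \<in> carrier G" using h stab_H insert by auto
  have "[co (compose (carrier G) t h y) l = (if l \<in> insert i F then 0 else co y l)] (mod m l)"
    if l: "l < n" for l
  proof -
    have *: "[co (compose (carrier G) t h y) l
      = (if l = i then co (h y) i + (- co y i) * co (h y) s else co (h y) l)] (mod m l)"
      using updatesD[OF t(2) hy l] \<open>y \<in> carrier G\<close> by (cases "l = i") (simp_all add: compose_eq)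
    show ?thesis
    proof (cases "l = i")
      case True
      have "[co (h y) s = 1] (mod m s)"
        using h(2)[of s] insert.prems by (auto intro: cong_trans split: if_splits)
      then have "[(- co y i) * co (h y) s = (- co y i) * 1] (mod m i)"
        using i by (intro mult_cong) auto
      with h(2)[OF l] True insert.hyps
      have "[co (h y) i + (- co y i) * co (h y) s = co y i + (- co y i) * 1] (mod m i)"
        by (intro cong_add) auto
      with * True show ?thesis by (auto intro: cong_trans)
    next
      case False
      then show ?thesis using * h(2)[OF l] by (auto intro: cong_trans)
    qed
  qed
  then show ?case using stab_compose t h by blast
qed

section \<open>Producing a unit in coordinate \<open>s\<close>\<close>

text \<open>Euclidean algorithm on the coordinates of modulus \<open>0\<close> from \<open>s\<close>
  on, which are genuine integers; the last assumption says that their gcd is \<open>1\<close>. The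
  sum of their absolute values decreases, and coprimality to \<open>m s = 0\<close> means being a
  unit.\<close>

lemma make_unit_infinite:
  assumes "s < n" "m s = 0" "y \<in> carrier G"
    and "\<And>d. (\<And>j. s \<le> j \<Longrightarrow> j < n \<Longrightarrow> m j = 0 \<Longrightarrow> d dvd co y j) \<Longrightarrow> is_unit d"
  shows "\<exists>h \<in> stab s. coprime (co (h y) s) (m s)"
  using assms(3,4)
proof (induction "\<Sum>j | s \<le> j \<and> j < n \<and> m j = 0. nat \<bar>co y j\<bar>" arbitrary: y rule: less_induct)
  case less
  let ?J = "{j. s \<le> j \<and> j < n \<and> m j = 0}"
  have fin: "finite ?J" by simp
  show ?case
  proof (cases "\<exists>i\<in>?J. \<exists>j\<in>?J. i \<noteq> j \<and> co y j \<noteq> 0 \<and> \<bar>co y j\<bar> \<le> \<bar>co y i\<bar>")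
    case True
    then obtain i j where ij: "i \<in> ?J" "j \<in> ?J" "i \<noteq> j" "co y j \<noteq> 0" "\<bar>co y j\<bar> \<le> \<bar>co y i\<bar>" by blast
    \<comment> \<open>The sign moves coordinate \<open>i\<close> towards zero; the nonzero step is
      at most its absolute value.\<close>
    define a :: int where "a = (if (co y i > 0) = (co y j > 0) then -1 else 1)"
    have a: "\<bar>co y i + a * co y j\<bar> < \<bar>co y i\<bar>" using ij by (auto simp: a_def split: if_splits)
    obtain t where t: "t \<in> stab s" "updates i 1 a j t"
      using stab_transvection[of i j s a] ij by auto
    have ty: "t y \<in> carrier G" using t stab_H less.prems by auto
    have co_t: "co (t y) l = (if l = i then co y i + a * co y j else co y l)" if "l \<in> ?J" for l
      using updatesD[OF t(2) less.prems(1), of l] that by (auto split: if_splits)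
    have "(\<Sum>l\<in>?J. nat \<bar>co (t y) l\<bar>) < (\<Sum>l\<in>?J. nat \<bar>co y l\<bar>)"
      using fin by (rule sum_strict_mono_ex1) (use co_t a ij in auto)
    \<comment> \<open>The step is reversible, so common divisors are preserved.\<close>
    moreover have "is_unit d" if d: "\<And>l. s \<le> l \<Longrightarrow> l < n \<Longrightarrow> m l = 0 \<Longrightarrow> d dvd co (t y) l" for d
    proof (rule less.prems(2))
      fix l assume l: "s \<le> l" "l < n" "m l = 0"
      have "d dvd co y j" using d[of j] co_t[of j] ij by auto
      moreover have "d dvd co y i + a * co y j" using d[of i] co_t[of i] ij by auto
      ultimately have "d dvd co y i" by (simp add: dvd_add_left_iff)
      then show "d dvd co y l" using d[of l] co_t[of l] l by (cases "l = i") auto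
    qed
    ultimately obtain h where "h \<in> stab s" "coprime (co (h (t y)) s) (m s)"
      using less.hyps[of "t y"] ty by blast
    then have "coprime (co (compose (carrier G) h t y) s) (m s)" "compose (carrier G) h t \<in> stab s"
      using less.prems stab_compose t by (auto simp: compose_eq)
    then show ?thesis by blast
  next
    case False
    have "\<not> is_unit (0::int)" by simp
    \<comment> \<open>If all these coordinates vanished, \<open>0\<close> would be a common divisor
      and hence a unit.\<close>
    then obtain j where j: "j \<in> ?J" "co y j \<noteq> 0"
      using less.prems(2)[of 0] by auto
    have "\<bar>co y i'\<bar> < \<bar>co y j'\<bar>" if "i' \<in> ?J" "j' \<in> ?J" "i' \<noteq> j'" "co y j' \<noteq> 0" for i' j'
      using False that by (meson not_le)
    \<comment> \<open>Of two nonzero coordinates, each would be strictly smaller in absolute value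
      than the other.\<close>
    from this[of _ j] this[of j] have others: "co y l = 0" if "l \<in> ?J" "l \<noteq> j" for l
      using j that by (metis less_asym)
    have unit: "is_unit (co y j)"
    proof (rule less.prems(2))
      fix l assume "s \<le> l" "l < n" "m l = 0"
      then show "co y j dvd co y l" using others[of l] by (cases "l = j") auto
    qed
    show ?thesis
    proof (cases "j = s")
      case True
      then show ?thesis using unit less.prems assms by (intro bexI[OF _ stab_id]) auto
    next
      case False
      \<comment> \<open>The only nonzero coordinate is at \<open>j\<close>, so coordinate
        \<open>s\<close> is zero and adding coordinate \<open>j\<close> copies the unit
        there.\<close>
      obtain t where t: "t \<in> stab s" "updates s 1 1 j t"
        using stab_transvection[of s j s 1] j False assms by auto
      have "co (t y) s = co y j"
        using updatesD[OF t(2) less.prems(1) \<open>s < n\<close>] others[of s] assms False by simp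
      then have "coprime (co (t y) s) (m s)" using unit assms by simp
      then show ?thesis using t by blast
    qed
  qed
qed

lemma make_unit:
  assumes s: "s < n" and y: "y \<in> carrier G"
    and f: "\<And>j. s \<le> j \<Longrightarrow> j < n \<Longrightarrow> m s dvd m j * f j"
    and sum: "[(\<Sum>j\<in>{s..<n}. f j * co y j) = 1] (mod m s)"
  shows "\<exists>h \<in> stab s. coprime (co (h y) s) (m s)"
proof (cases "m s = 0")
  case True
  show ?thesis
  proof (rule make_unit_infinite[OF s True y])
    fix d assume d: "\<And>j. s \<le> j \<Longrightarrow> j < n \<Longrightarrow> m j = 0 \<Longrightarrow> d dvd co y j"
    \<comment> \<open>With \<open>m s = 0\<close>, admissibility forces \<open>f j = 0\<close>
      whenever \<open>m j \<noteq> 0\<close>: only coordinates of modulus \<open>0\<close>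
      contribute.\<close>
    have "d dvd f j * co y j" if "s \<le> j" "j < n" for j
      using d[of j] f[of j] that True by (cases "m j = 0") auto
    then have "d dvd (\<Sum>j\<in>{s..<n}. f j * co y j)" by (intro dvd_sum) auto
    with sum True show "is_unit d" by simp
  qed
next
  case False
  define b where "b = (\<Sum>j\<in>{s<..<n}. f j * co y j)"
  have "{s..<n} = insert s {s<..<n}" using s by auto
  then have sum': "[f s * co y s + b = 1] (mod m s)" using sum by (simp add: b_def)
  have "\<exists>t. coprime (co y s + t * b) (m s)"
  proof (rule coprime_add_multiple[OF False])
    fix d assume d: "d dvd co y s" "d dvd b" "d dvd m s"
    \<comment> \<open>A common divisor of \<open>co y s\<close>, \<open>b\<close> and
      \<open>m s\<close> divides \<open>1\<close>, because \<open>f s * co y s + b\<close> is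
      \<open>1\<close> modulo \<open>m s\<close>.\<close>
    have "d dvd f s * co y s + b - 1" using sum' d by (auto simp: cong_iff_dvd_diff intro: dvd_trans)
    moreover have "d dvd f s * co y s + b" using d by simp
    ultimately show "is_unit d" by (metis diff_diff_eq2 dvd_diff add_diff_cancel_left')
  qed
  then obtain t where t: "coprime (co y s + t * b) (m s)" by blast
  \<comment> \<open>Multiples of admissible coefficients are admissible, so \<open>t * b\<close> can
    be added to coordinate \<open>s\<close>.\<close>
  have "\<exists>h \<in> stab s. \<forall>l<n. [co (h y) l = co y l + (if l = s then \<Sum>j\<in>{s<..<n}. (t * f j) * co y j else 0)] (mod m l)"
    using s y f by (intro add_combination) (auto simp: mult.left_commute)
  then obtain h where h: "h \<in> stab s" "[co (h y) s = co y s + (\<Sum>j\<in>{s<..<n}. (t * f j) * co y j)] (mod m s)"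
    using s by auto
  have "(\<Sum>j\<in>{s<..<n}. (t * f j) * co y j) = t * b" by (simp add: b_def sum_distrib_left mult.assoc)
  with h t have "coprime (co (h y) s) (m s)" using cong_imp_coprime cong_sym by metis
  with h show ?thesis by blast
qed

section \<open>Reducing an automorphism to the identity\<close>

lemma auto_inv:
  assumes "\<phi> \<in> auto G"
  obtains \<rho> where "\<rho> \<in> auto G" "\<And>x. x \<in> carrier G \<Longrightarrow> \<rho> (\<phi> x) = x"
proof
  let ?r = "restrict (inv_into (carrier G) \<phi>) (carrier G)"
  show "?r \<in> auto G"
    using assms restrict_inv_into_hom restrict_inv_into_Bij unfolding auto_def by blast
  fix x assume "x \<in> carrier G"
  then show "?r (\<phi> x) = x"
    using assms by (auto simp: auto_def Bij_def bij_betw_def)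
qed

lemma auto_compose: "\<phi> \<in> auto G \<Longrightarrow> \<rho> \<in> auto G \<Longrightarrow> compose (carrier G) \<phi> \<rho> \<in> auto G"
  using subgroup.m_closed[OF subgroup_auto, of \<phi> \<rho>] by (simp add: BijGroup_def auto_def)

lemma move_to_basis:
  assumes \<phi>: "\<phi> \<in> auto G" and fixed: "\<And>l. l < s \<Longrightarrow> \<phi> (basis l) = basis l" and s: "s < n"
  shows "\<exists>h \<in> stab s. h (\<phi> (basis s)) = basis s"
proof -
  have \<phi>_closed: "\<phi> x \<in> carrier G" if "x \<in> carrier G" for x
    using \<phi> that by (auto simp: auto_def hom_def)
  define y where "y = \<phi> (basis s)"
  have y: "y \<in> carrier G" using \<phi>_closed basis by (simp add: y_def)
  obtain \<rho> where \<rho>: "\<rho> \<in> auto G" "\<And>x. x \<in> carrier G \<Longrightarrow> \<rho> (\<phi> x) = x" using auto_inv[OF \<phi>] by blast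
  have \<rho>_hom: "\<rho> \<in> hom G G" using \<rho> by (simp add: auto_def)
  \<comment> \<open>This is row \<open>s\<close> of the matrix of the inverse \<open>\<rho>\<close>;
    applied to \<open>y\<close> it gives coordinate \<open>s\<close> of \<open>basis s\<close>,
    which is \<open>1\<close>.\<close>
  define f where "f j = co (\<rho> (basis j)) s" for j
  have "[co (basis s) s = (\<Sum>j<n. co y j * f j)] (mod m s)"
    using co_hom[OF \<rho>_hom y s] \<rho>(2)[OF basis(1)] by (simp add: f_def y_def)
  moreover have "[co (basis s) s = 1] (mod m s)" using basis(2)[of s s] s by simp
  moreover have "[(\<Sum>j<n. co y j * f j) = (\<Sum>j<n. if s \<le> j then f j * co y j else 0)] (mod m s)"
  proof (rule cong_sum)
    fix j assume "j \<in> {..<n}"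
    show "[co y j * f j = (if s \<le> j then f j * co y j else 0)] (mod m s)"
    proof (cases "s \<le> j")
      case False
      \<comment> \<open>The inverse fixes the same basis vectors, so the entries of the row before
        position \<open>s\<close> vanish modulo \<open>m s\<close>.\<close>
      then have "\<rho> (basis j) = basis j" using \<rho>(2)[OF basis(1)[of j]] fixed[of j] by simp
      then have "[f j = 0] (mod m s)" using basis(2)[of s j] s False by (simp add: f_def)
      then have "[co y j * f j = co y j * 0] (mod m s)" by (rule cong_scalar_left)
      with False show ?thesis by simp
    qed (simp add: mult.commute)
  qed
  moreover have "(\<Sum>j<n. if s \<le> j then f j * co y j else 0) = (\<Sum>j\<in>{s..<n}. f j * co y j)"
    by (rule sum.mono_neutral_cong_right) auto
  ultimately have sum: "[(\<Sum>j\<in>{s..<n}. f j * co y j) = 1] (mod m s)"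
    by (metis (no_types, lifting) cong_sym cong_trans)
  obtain h1 where h1: "h1 \<in> stab s" "coprime (co (h1 y) s) (m s)"
    using make_unit[OF s y _ sum] modulus_dvd_co_hom[OF \<rho>_hom s] unfolding f_def by blast
  obtain u where u: "[co (h1 y) s * u = 1] (mod m s)" using cong_solve_coprime_int[OF h1(2)] by blast
  have "coprime u (m s)"
    using u by (metis coprime_iff_invertible_int mult.commute)
  then obtain h2 where h2: "h2 \<in> stab s" "updates s u 0 s h2" using stab_scaling[OF s] by blast
  define g where "g = compose (carrier G) h2 h1"
  have g: "g \<in> stab s" using h1 h2 stab_compose by (simp add: g_def)
  have h1y: "h1 y \<in> carrier G" using h1 stab_H y by auto
  have "[co (g y) s = u * co (h1 y) s] (mod m s)"
    using updatesD[OF h2(2) h1y s] y by (simp add: g_def compose_eq)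
  then have gs: "[co (g y) s = 1] (mod m s)" using u by (metis cong_trans mult.commute)
  have gy: "g y \<in> carrier G" using g stab_H y by auto
  \<comment> \<open>Since \<open>g y\<close> is the image of \<open>basis s\<close> under an
    endomorphism, its coordinates are admissible coefficients for clearing.\<close>
  have "compose (carrier G) g \<phi> \<in> hom G G"
    using auto_compose[OF H_auto[OF stab_H[OF g]] \<phi>] by (simp add: auto_def)
  from modulus_dvd_co_hom[OF this, of _ s]
  have order: "m i dvd m s * co (g y) i" if "i < n" for i
    using that by (simp add: compose_eq y_def basis)
  have "\<exists>h \<in> stab s. \<forall>l<n. [co (h (g y)) l = (if l \<in> {..<n} - {s} then 0 else co (g y) l)] (mod m l)"
    using s gs gy order by (intro clear_coordinates) auto
  then obtain h where h: "h \<in> stab s"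
    "\<And>l. l < n \<Longrightarrow> [co (h (g y)) l = (if l \<in> {..<n} - {s} then 0 else co (g y) l)] (mod m l)"
    by blast
  have "h (g y) = basis s"
  proof (rule co_eqI)
    fix l assume l: "l < n"
    have "[co (h (g y)) l = (if l = s then 1 else 0)] (mod m l)"
      using h(2)[OF l] gs l by (auto intro: cong_trans split: if_splits)
    then show "[co (h (g y)) l = co (basis s) l] (mod m l)"
      using basis(2)[OF l, of s] by (metis (no_types, lifting) cong_sym cong_trans)
  qed (use h stab_H gy basis in auto)
  then have "compose (carrier G) h g \<in> stab s" "compose (carrier G) h g y = basis s"
    using stab_compose h g y by (auto simp: compose_eq)
  then show ?thesis unfolding y_def by blast
qed

lemma auto_fixing_basis:
  assumes \<phi>: "\<phi> \<in> auto G" and fixed: "\<And>l. l < n \<Longrightarrow> \<phi> (basis l) = basis l"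
  shows "\<phi> = (\<lambda>x \<in> carrier G. x)"
proof (rule extensionalityI)
  fix x assume x: "x \<in> carrier G"
  have "\<phi> x = x"
  proof (rule co_eqI)
    fix i assume i: "i < n"
    have "[co (\<phi> x) i = (\<Sum>j<n. co x j * co (\<phi> (basis j)) i)] (mod m i)"
      using \<phi> x i by (intro co_hom) (auto simp: auto_def)
    also have "[(\<Sum>j<n. co x j * co (\<phi> (basis j)) i) = (\<Sum>j<n. co x j * (if i = j then 1 else 0))] (mod m i)"
      using fixed i basis by (intro cong_sum cong_scalar_left) auto
    also have "(\<Sum>j<n. co x j * (if i = j then 1 else 0)) = co x i"
      using i by (simp add: if_distrib cong: if_cong)
    finally show "[co (\<phi> x) i = co x i] (mod m i)" .
  qed (use x \<phi> in \<open>auto simp: auto_def hom_def\<close>)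
  then show "\<phi> x = (\<lambda>x \<in> carrier G. x) x" using x by simp
qed (use \<phi> in \<open>auto simp: auto_def Bij_def\<close>)

text \<open>Induction on the number \<open>n - s\<close> of basis vectors not yet known to be fixed.
  Composing with an element of \<open>stab s\<close> fixes one more and keeps the earlier ones; at
  the end the identity remains, and the composed factors are undone inside \<open>H\<close>.\<close>

theorem auto_subset: "auto G \<subseteq> H"
proof
  have "\<phi> \<in> H" if "\<phi> \<in> auto G" "\<And>l. l < s \<Longrightarrow> \<phi> (basis l) = basis l" "s \<le> n" for \<phi> s
    using that
  proof (induction "n - s" arbitrary: s \<phi>)
    case 0
    then have "\<phi> = (\<lambda>x \<in> carrier G. x)" by (intro auto_fixing_basis) auto
    then show ?case using H_id by metis
  next
    case (Suc N)
    obtain h where h: "h \<in> stab s" "h (\<phi> (basis s)) = basis s"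
      using move_to_basis[OF Suc.prems(1,2)] Suc.hyps(2) by fastforce
    define \<psi> where "\<psi> = compose (carrier G) h \<phi>"
    have "\<psi> \<in> auto G" using h stab_H H_auto auto_compose Suc.prems by (simp add: \<psi>_def)
    moreover have "\<psi> (basis l) = basis l" if "l < Suc s" for l
      using h Suc.prems(2)[of l] that by (cases "l = s") (auto simp: \<psi>_def compose_eq basis stab_def)
    ultimately have "\<psi> \<in> H" using Suc.hyps(1)[of "Suc s" \<psi>] Suc.hyps(2) by simp
    obtain g where g: "g \<in> H" "\<forall>x \<in> carrier G. g (h x) = x" using H_inv h stab_H by blast
    have "compose (carrier G) g \<psi> = \<phi>"
    proof (rule extensionalityI)
      fix x assume "x \<in> carrier G"
      then show "compose (carrier G) g \<psi> x = \<phi> x"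
        using g Suc.prems(1) by (auto simp: \<psi>_def compose_eq auto_def hom_def)
    qed (use Suc.prems(1) in \<open>auto simp: auto_def Bij_def\<close>)
    then show ?case using H_compose g \<open>\<psi> \<in> H\<close> by metis
  qed
  from this[of _ 0] show "\<phi> \<in> H" if "\<phi> \<in> auto G" for \<phi> using that by simp
qed

end

section \<open>Coordinates on the finitely generated abelian group\<close>

text \<open>
  Coordinates are counted from \<open>0\<close>: the free ones are \<open>0..<k\<close>, and torsion coordinate \<open>i\<close> has index
  \<open>k + i - 1\<close>.
\<close>

definition coord :: "nat \<Rightarrow> fg_elt \<Rightarrow> nat \<Rightarrow> int" where
  "coord k x i = (if i < k then fst x (Suc i) else snd x (Suc (i - k)))"

definition modulus :: "nat \<Rightarrow> (nat \<Rightarrow> nat) \<Rightarrow> nat \<Rightarrow> int" where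
  "modulus k \<mu> i = (if i < k then 0 else int (\<mu> (Suc (i - k))))"

locale invariant_factors =
  fixes k r :: nat and \<mu> :: "nat \<Rightarrow> nat"
  assumes pos: "\<And>i. i \<in> {1..r} \<Longrightarrow> 0 < \<mu> i"
    and chain: "\<And>i. i \<in> {1..<r} \<Longrightarrow> \<mu> (Suc i) dvd \<mu> i"
begin

abbreviation "G \<equiv> fg_abelian k r \<mu>"

lemma carrier_iff:
  "x \<in> carrier G \<longleftrightarrow> fst x \<in> extensional {1..k} \<and> snd x \<in> extensional {1..r}
     \<and> (\<forall>i\<in>{1..r}. snd x i \<in> {0..<int (\<mu> i)})"
proof -
  \<comment> \<open>Positivity matters here: \<open>integer_mod_group 0\<close> is the group of all
    integers.\<close>
  have "carrier (integer_mod_group (\<mu> i)) = {0..<int (\<mu> i)}" if "i \<in> {1..r}" for i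
    using pos[OF that] by (simp add: carrier_integer_mod_group)
  then show ?thesis by (cases x) (auto simp: fg_abelian_def PiE_iff)
qed

lemma mu_dvd:
  assumes "1 \<le> i" "i \<le> j" "j \<le> r"
  shows "\<mu> j dvd \<mu> i"
  using assms(2,3)
proof (induction j rule: dec_induct)
  case (step j)
  then show ?case using chain[of j] assms(1) by (auto intro: dvd_trans)
qed simp

sublocale cyclic_coordinates G "coord k" "k + r" "modulus k \<mu>"
proof -
  interpret group G
    unfolding fg_abelian_def by (intro DirProd_group product_group) auto
  show "cyclic_coordinates G (coord k) (k + r) (modulus k \<mu>)"
  proof
    fix x y i assume "x \<in> carrier G" "y \<in> carrier G" "i < k + r"
    then show "[coord k (x \<otimes>\<^bsub>G\<^esub> y) i = coord k x i + coord k y i] (mod modulus k \<mu> i)"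
      by (auto simp: coord_def modulus_def fg_abelian_def mult_DirProd' cong_def)
  next
    fix x y assume xy: "x \<in> carrier G" "y \<in> carrier G"
      and eq: "\<And>i. i < k + r \<Longrightarrow> [coord k x i = coord k y i] (mod modulus k \<mu> i)"
    have "fst x = fst y"
    proof (rule extensionalityI)
      fix i assume "i \<in> {1..k}"
      then show "fst x i = fst y i" using eq[of "i - 1"] by (cases i) (auto simp: coord_def modulus_def)
    qed (use xy carrier_iff in auto)
    moreover have "snd x = snd y"
    proof (rule extensionalityI)
      fix i assume i: "i \<in> {1..r}"
      then have "[snd x i = snd y i] (mod int (\<mu> i))"
        using eq[of "k + i - 1"] by (cases i) (auto simp: coord_def modulus_def)
      moreover have "snd x i \<in> {0..<int (\<mu> i)}" "snd y i \<in> {0..<int (\<mu> i)}"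
        using xy i carrier_iff by blast+
      ultimately show "snd x i = snd y i" by (auto simp: cong_def)
    qed (use xy carrier_iff in auto)
    ultimately show "x = y" by (simp add: prod_eq_iff)
  next
    fix f :: "nat \<Rightarrow> int"
    \<comment> \<open>The index shift passes from counting at \<open>0\<close> to counting at
      \<open>1\<close>; torsion values are reduced to lie in the carrier.\<close>
    let ?x = "(\<lambda>i\<in>{1..k}. f (i - 1), \<lambda>i\<in>{1..r}. f (k + i - 1) mod int (\<mu> i))"
    have "?x \<in> carrier G" using pos by (auto simp: carrier_iff)
    moreover have "[coord k ?x i = f i] (mod modulus k \<mu> i)" if "i < k + r" for i
      using that by (auto simp: coord_def modulus_def)
    ultimately show "\<exists>x\<in>carrier G. \<forall>i<k + r. [coord k x i = f i] (mod modulus k \<mu> i)" by blast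
  qed
qed

section \<open>The elementary automorphisms as coordinate updates\<close>

text \<open>The target has modulus \<open>0\<close>, so congruence is equality, coprimality means
  \<open>is_unit u\<close>, and admissibility becomes
  \<open>modulus k \<mu> j * a = 0\<close>.\<close>

lemma free_update:
  assumes h: "h = restrict (\<lambda>(w, \<eta>). (w(i := g w \<eta>), \<eta>)) (carrier G)" and i: "i \<in> {1..k}"
    and g: "\<And>w \<eta>. (w, \<eta>) \<in> carrier G \<Longrightarrow> g w \<eta> = u * w i + a * coord k (w, \<eta>) j"
    and j: "j < k + r" "a = 0 \<or> i - 1 \<noteq> j"
    and u: "is_unit u" and a: "modulus k \<mu> j * a = 0"
  shows "h \<in> auto G \<and> updates (i - 1) u a j h"
proof -
  have upd: "updates (i - 1) u a j h"
    unfolding updates_def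
  proof (intro ballI allI impI)
    fix x l assume "x \<in> carrier G"
    then show "[coord k (h x) l = (if l = i - 1 then u * coord k x (i - 1) + a * coord k x j else coord k x l)]
        (mod modulus k \<mu> l)"
      using i g[of "fst x" "snd x"] by (auto simp: h coord_def case_prod_unfold)
  qed
  moreover have "h \<in> auto G"
  proof (rule updates_auto[OF _ _ upd])
    show "h \<in> carrier G \<rightarrow> carrier G"
      using i by (auto simp: h carrier_iff extensional_def)
  qed (use i j u a in \<open>auto simp: h modulus_def\<close>)
  ultimately show ?thesis by blast
qed

lemma torsion_update:
  assumes h: "h = restrict (\<lambda>(w, \<eta>). (w, \<eta>(i := g w \<eta>))) (carrier G)" and i: "i \<in> {1..r}"
    and g: "\<And>w \<eta>. (w, \<eta>) \<in> carrier G \<Longrightarrow> g w \<eta> = (u * \<eta> i + a * coord k (w, \<eta>) j) mod int (\<mu> i)"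
    and j: "j < k + r" "a = 0 \<or> k + i - 1 \<noteq> j"
    and u: "coprime u (int (\<mu> i))" and a: "int (\<mu> i) dvd modulus k \<mu> j * a"
  shows "h \<in> auto G \<and> updates (k + i - 1) u a j h"
proof -
  have upd: "updates (k + i - 1) u a j h"
    unfolding updates_def
  proof (intro ballI allI impI)
    fix x l assume x: "x \<in> carrier G"
    then have "g (fst x) (snd x) = (u * snd x i + a * coord k x j) mod int (\<mu> i)"
      using g[of "fst x" "snd x"] by simp
    then show "[coord k (h x) l = (if l = k + i - 1 then u * coord k x (k + i - 1) + a * coord k x j else coord k x l)]
        (mod modulus k \<mu> l)"
      using i x by (auto simp: h coord_def modulus_def case_prod_unfold cong_def)
  qed
  moreover have "h \<in> auto G"
  proof (rule updates_auto[OF _ _ upd])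
    show "h \<in> carrier G \<rightarrow> carrier G"
    proof
      fix x assume x: "x \<in> carrier G"
      then have "g (fst x) (snd x) = (u * snd x i + a * coord k x j) mod int (\<mu> i)"
        using g[of "fst x" "snd x"] by simp
      then have "g (fst x) (snd x) \<in> {0..<int (\<mu> i)}" using pos[OF i] by simp
      then show "h x \<in> carrier G" using x i by (auto simp: h carrier_iff extensional_def case_prod_unfold)
    qed
  qed (use i j u a in \<open>auto simp: h modulus_def\<close>)
  ultimately show ?thesis by blast
qed

lemma psi_free_aut: "i \<in> {1..k} \<Longrightarrow>
    psi_free_aut k r \<mu> i \<in> auto G \<and> updates (i - 1) (- 1) 0 (i - 1) (psi_free_aut k r \<mu> i)"
  by (rule free_update[OF psi_free_aut_def]) auto

text \<open>Elements of \<open>mod_units\<close> are reduced, whereas scalings are needed for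
  arbitrary integers \<open>u\<close>; reducing \<open>u\<close> does not change the map.\<close>

lemma psi_tors_aut: "i \<in> {1..r} \<Longrightarrow> coprime u (int (\<mu> i)) \<Longrightarrow>
    psi_tors_aut k r \<mu> i (u mod int (\<mu> i)) \<in> auto G \<and>
    updates (k + i - 1) u 0 (k + i - 1) (psi_tors_aut k r \<mu> i (u mod int (\<mu> i)))"
  by (rule torsion_update[OF psi_tors_aut_def]) (auto simp: mod_mult_left_eq)

lemma alpha_aut: "i \<in> {1..k} \<Longrightarrow> j \<in> {1..k} \<Longrightarrow> i \<noteq> j \<Longrightarrow>
    alpha_aut k r \<mu> i j \<in> auto G \<and> updates (i - 1) 1 1 (j - 1) (alpha_aut k r \<mu> i j)"
  by (rule free_update[OF alpha_aut_def]) (auto simp: coord_def modulus_def)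

lemma beta_aut: "i \<in> {1..r} \<Longrightarrow> j \<in> {1..k} \<Longrightarrow>
    beta_aut k r \<mu> i j \<in> auto G \<and> updates (k + i - 1) 1 1 (j - 1) (beta_aut k r \<mu> i j)"
  by (rule torsion_update[OF beta_aut_def]) (auto simp: coord_def modulus_def mod_add_right_eq)

lemma gamma_aut: "1 \<le> j \<Longrightarrow> j < i \<Longrightarrow> i \<le> r \<Longrightarrow>
    gamma_aut k r \<mu> i j \<in> auto G \<and> updates (k + i - 1) 1 1 (k + j - 1) (gamma_aut k r \<mu> i j)"
  by (rule torsion_update[OF gamma_aut_def]) (auto simp: coord_def modulus_def mod_add_right_eq mu_dvd)

text \<open>The coefficient is admissible because
  \<open>\<mu> j * (\<mu> i div \<mu> j) = \<mu> i\<close>.\<close>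

lemma delta_aut: "1 \<le> i \<Longrightarrow> i < j \<Longrightarrow> j \<le> r \<Longrightarrow>
    delta_aut k r \<mu> i j \<in> auto G \<and>
    updates (k + i - 1) 1 (int (\<mu> i div \<mu> j)) (k + j - 1) (delta_aut k r \<mu> i j)"
  using mu_dvd[of i j]
  by (intro torsion_update[OF delta_aut_def])
    (auto simp: coord_def modulus_def simp flip: of_nat_mult)

lemma mod_units_iff:
  assumes "0 < \<mu> i"
  shows "u mod int (\<mu> i) \<in> mod_units (\<mu> i) \<longleftrightarrow> coprime u (int (\<mu> i))"
proof
  assume "u mod int (\<mu> i) \<in> mod_units (\<mu> i)"
  then obtain v where "u mod int (\<mu> i) * v mod int (\<mu> i) = 1 mod int (\<mu> i)"
    by (auto simp: mod_units_def)
  then have "[u * v = 1] (mod int (\<mu> i))" by (simp add: cong_def mod_mult_left_eq)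
  then show "coprime u (int (\<mu> i))" using coprime_iff_invertible_int by blast
next
  assume "coprime u (int (\<mu> i))"
  then obtain v where "[u * v = 1] (mod int (\<mu> i))" using coprime_iff_invertible_int by blast
  then have "u mod int (\<mu> i) * (v mod int (\<mu> i)) mod int (\<mu> i) = 1 mod int (\<mu> i)"
    by (simp add: cong_def mod_mult_eq)
  then show "u mod int (\<mu> i) \<in> mod_units (\<mu> i)"
    using assms by (auto simp: mod_units_def carrier_integer_mod_group intro!: bexI[of _ "v mod int (\<mu> i)"])
qed

lemma elementary_auts_subset: "elementary_auts k r \<mu> \<subseteq> auto G"
proof -
  have "psi_tors_aut k r \<mu> i u \<in> auto G" if "i \<in> {1..r}" "u \<in> mod_units (\<mu> i)" for i u
  proof -
    have "u mod int (\<mu> i) = u"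
      using that pos[of i] by (auto simp: mod_units_def carrier_integer_mod_group)
    then show ?thesis using psi_tors_aut[of i u] mod_units_iff[of i u] pos[of i] that by auto
  qed
  then show ?thesis
    unfolding elementary_auts_def
    using psi_free_aut alpha_aut beta_aut gamma_aut delta_aut by blast
qed

section \<open>The subgroup generated by the elementary automorphisms\<close>

abbreviation "H \<equiv> generate (AutoGroup G) (elementary_auts k r \<mu>)"

lemma elementary_in_H:
  shows "i \<in> {1..k} \<Longrightarrow> psi_free_aut k r \<mu> i \<in> H"
    and "i \<in> {1..r} \<Longrightarrow> u \<in> mod_units (\<mu> i) \<Longrightarrow> psi_tors_aut k r \<mu> i u \<in> H"
    and "i \<in> {1..k} \<Longrightarrow> j \<in> {1..k} \<Longrightarrow> i \<noteq> j \<Longrightarrow> alpha_aut k r \<mu> i j \<in> H"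
    and "i \<in> {1..r} \<Longrightarrow> j \<in> {1..k} \<Longrightarrow> beta_aut k r \<mu> i j \<in> H"
    and "1 \<le> j \<Longrightarrow> j < i \<Longrightarrow> i \<le> r \<Longrightarrow> gamma_aut k r \<mu> i j \<in> H"
    and "1 \<le> i \<Longrightarrow> i < j \<Longrightarrow> j \<le> r \<Longrightarrow> delta_aut k r \<mu> i j \<in> H"
  by (rule generate.incl; unfold elementary_auts_def; blast)+

lemma id_in_H: "(\<lambda>x \<in> carrier G. x) \<in> H"
  using generate.one[of "AutoGroup G"] by (simp add: AutoGroup_def BijGroup_def)

lemma H_scaling:
  assumes i: "i < k + r" and u: "coprime u (modulus k \<mu> i)"
  shows "\<exists>h \<in> H. updates i u 0 i h"
proof (cases "i < k")
  case True
  \<comment> \<open>Coprime to the modulus \<open>0\<close> means being a unit of \<int>.\<close>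
  then have "u = 1 \<or> u = - 1" using u by (auto simp: modulus_def)
  then show ?thesis
  proof
    assume "u = 1"
    then show ?thesis by (intro bexI[OF _ id_in_H]) (auto simp: updates_def)
  next
    assume "u = - 1"
    moreover have "psi_free_aut k r \<mu> (Suc i) \<in> H"
      using True by (intro elementary_in_H) auto
    ultimately show ?thesis using psi_free_aut[of "Suc i"] True by auto
  qed
next
  case False
  define i' where "i' = Suc (i - k)"
  have i': "i' \<in> {1..r}" "k + i' - 1 = i" "coprime u (int (\<mu> i'))"
    using i False u by (auto simp: i'_def modulus_def)
  have "psi_tors_aut k r \<mu> i' (u mod int (\<mu> i')) \<in> H"
    using i' mod_units_iff[of i' u] pos[of i']
    by (intro elementary_in_H) auto
  then show ?thesis using psi_tors_aut[of i' u] i' by auto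
qed

text \<open>For two torsion coordinates the divisibility chain makes the gcd the modulus of the
  later one. The coefficient is therefore \<open>1\<close> if the target is later
  (\<open>gamma_aut\<close>) and the quotient of the moduli if the source is later
  (\<open>delta_aut\<close>).\<close>

lemma H_transvection:
  assumes ij: "i < k + r" "j < k + r" "i \<noteq> j"
  shows "\<exists>h \<in> H. updates i 1 (if modulus k \<mu> j = 0 then 1
    else modulus k \<mu> i div gcd (modulus k \<mu> i) (modulus k \<mu> j)) j h"
    (is "\<exists>h \<in> H. updates i 1 ?c j h")
proof -
  define i' j' where "i' = Suc (i - k)" and "j' = Suc (j - k)"
  have i': "i' \<in> {1..r}" "k + i' - 1 = i" "modulus k \<mu> i = int (\<mu> i')" if "\<not> i < k"
    using ij that by (auto simp: i'_def modulus_def)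
  have j': "j' \<in> {1..r}" "k + j' - 1 = j" "modulus k \<mu> j = int (\<mu> j')" "0 < \<mu> j'" if "\<not> j < k"
    using ij that pos[of j'] by (auto simp: j'_def modulus_def)
  consider "i < k" "j < k" | "i < k" "\<not> j < k" | "\<not> i < k" "j < k"
    | "\<not> i < k" "\<not> j < k" "j < i" | "\<not> i < k" "\<not> j < k" "i < j"
    using ij by linarith
  then show ?thesis
  proof cases
    case 1
    have "alpha_aut k r \<mu> (Suc i) (Suc j) \<in> H"
      using 1 ij by (intro elementary_in_H) auto
    moreover have "?c = 1" using 1 by (simp add: modulus_def)
    ultimately show ?thesis using alpha_aut[of "Suc i" "Suc j"] 1 ij by auto
  next
    case 2
    \<comment> \<open>There is no nonzero homomorphism from a finite cyclic group to \<int>, so the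
      identity serves.\<close>
    then have "?c = 0" using j' by (simp add: modulus_def)
    then show ?thesis by (intro bexI[OF _ id_in_H]) (auto simp: updates_def)
  next
    case 3
    have "beta_aut k r \<mu> i' (Suc j) \<in> H"
      using 3 i' by (intro elementary_in_H) auto
    moreover have "?c = 1" using 3 by (simp add: modulus_def)
    ultimately show ?thesis using beta_aut[of i' "Suc j"] 3 i' by auto
  next
    case 4
    then have *: "1 \<le> j'" "j' < i'" "i' \<le> r" using i' by (auto simp: i'_def j'_def)
    then have "gamma_aut k r \<mu> i' j' \<in> H"
      by (intro elementary_in_H) auto
    moreover have "?c = 1"
      using 4 i' j' mu_dvd[of j' i'] * pos[of i'] by (simp add: gcd_nat.absorb1)
    ultimately show ?thesis using gamma_aut[OF *] 4 i' j' by auto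
  next
    case 5
    then have *: "1 \<le> i'" "i' < j'" "j' \<le> r" using j' by (auto simp: i'_def j'_def)
    then have "delta_aut k r \<mu> i' j' \<in> H"
      by (intro elementary_in_H) auto
    moreover have "?c = int (\<mu> i' div \<mu> j')"
      using 5 i' j' mu_dvd[of i' j'] * by (simp add: gcd_nat.absorb2 zdiv_int)
    ultimately show ?thesis using delta_aut[OF *] 5 i' j' by auto
  qed
qed

lemma auto_generated: "generate (AutoGroup G) (elementary_auts k r \<mu>) = carrier (AutoGroup G)"
proof
  interpret A: group "AutoGroup G" by (rule AutoGroup)
  have carrier: "carrier (AutoGroup G) = auto G" by (simp add: AutoGroup_def)
  then have sub: "subgroup H (AutoGroup G)"
    using elementary_auts_subset by (intro A.generate_is_subgroup) simp
  then show "H \<subseteq> carrier (AutoGroup G)" by (rule subgroup.subset)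
  interpret transvection_closed G "coord k" "k + r" "modulus k \<mu>" H
    by (intro transvection_closed.intro transvection_closed_axioms.intro
        cyclic_coordinates_axioms sub H_scaling H_transvection)
  show "carrier (AutoGroup G) \<subseteq> H" using auto_subset carrier by simp
qed

end

theorem theorem2p1:
  fixes k r :: nat and \<mu> :: "nat \<Rightarrow> nat"
  assumes pos: "\<And>i. i \<in> {1..r} \<Longrightarrow> 0 < \<mu> i"
    and chain: "\<And>i. i \<in> {1..<r} \<Longrightarrow> \<mu> (Suc i) dvd \<mu> i"
  shows "elementary_auts k r \<mu> \<subseteq> auto (fg_abelian k r \<mu>)
       \<and> generate (AutoGroup (fg_abelian k r \<mu>)) (elementary_auts k r \<mu>)
         = carrier (AutoGroup (fg_abelian k r \<mu>))"
proof -
  interpret invariant_factors k r \<mu> using pos chain by unfold_locales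
  show ?thesis using elementary_auts_subset auto_generated by blast
qed

end
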